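(* For every sequent $\Gamma\Rightarrow\Delta$: if $\Gamma\Rightarrow\Delta$ is provable in $\mathsf{Grz_{Seq}}+\mathsf{cut}$, then $\Gamma\Rightarrow\Delta$ is provable in $\mathsf{Grz}_\infty+\mathsf{cut}$.
   Context: Formulas are given by $A ::= \bot \mid p \mid (A\to A)\mid \Box A$, where $p$ ranges over atomic propositions. A sequent is an expression $\Gamma\Rightarrow\Delta$ with $\Gamma,\Delta$ finite multisets of formulas; a comma denotes multiset union, and for $\Gamma=A_1,\dots,A_n$ we set $\Box\Gamma:=\Box A_1,\dots,\Box A_n$. Rules common to the calculi below: - $(\to_L)$: from $\Gamma,B\Rightarrow\Delta$ and $\Gamma\Rightarrow A,\Delta$ infer $\Gamma,A\to B\Rightarrow\Delta$; - $(\to_R)$: from $\Gamma,A\Rightarrow B,\Delta$ infer $\Gamma\Rightarrow A\to B,\Delta$; - $(\mathsf{refl})$: from $\Gamma,A,\Box A\Rightarrow\Delta$ infer $\Gamma,\Box A\Rightarrow\Delta$; - $(\mathsf{cut})$: from $\Gamma\Rightarrow A,\Delta$ and $\Gamma,A\Rightarrow\Delta$ infer $\Gamma\Rightarrow\Delta$. $\mathsf{Grz_{Seq}}$ has initial sequents $\Gamma,A\Rightarrow A,\Delta$ ($A$ any formula) and $\Gamma,\bot\Rightarrow\Delta$, and the rules $(\to_L)$, $(\to_R)$, $(\mathsf{refl})$ and $(\Box_{\mathsf{Grz}})$: from $\Box\Pi,\Box(A\to\Box A)\Rightarrow A$ infer $\Gamma,\Box\Pi\Rightarrow\Box A,\Delta$.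 $\mathsf{Grz_{Seq}}+\mathsf{cut}$ is $\mathsf{Grz_{Seq}}$ together with $(\mathsf{cut})$. Proofs in $\mathsf{Grz_{Seq}}$ and $\mathsf{Grz_{Seq}}+\mathsf{cut}$ are ordinary finite proof trees. $\mathsf{Grz}_\infty+\mathsf{cut}$ has initial sequents $\Gamma,p\Rightarrow p,\Delta$ ($p$ atomic) and $\Gamma,\bot\Rightarrow\Delta$, and the rules $(\to_L)$, $(\to_R)$, $(\mathsf{refl})$, $(\mathsf{cut})$ and $(\Box)$: from $\Gamma,\Box\Pi\Rightarrow A,\Delta$ (left premise) and $\Box\Pi\Rightarrow A$ (right premise) infer $\Gamma,\Box\Pi\Rightarrow\Box A,\Delta$. An $\infty$-proof in $\mathsf{Grz}_\infty+\mathsf{cut}$ is a possibly infinite tree whose nodes are marked by sequents and whose leaves are marked by initial sequents, constructed according to these rules, such that every infinite branch passes through a right premise of $(\Box)$ infinitely many times. A sequent is provable in $\mathsf{Grz}_\infty+\mathsf{cut}$ if it marks the root of some $\infty$-proof. *)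

theory Defs
  imports "HOL-Library.Multiset"
begin

datatype 'p fm =
    Bot
  | Atom 'p
  | Imp "'p fm" "'p fm"  (infixr "\<^bold>\<longrightarrow>" 75)
  | Box "'p fm"

datatype 'p sequent =
  Sequent "'p fm multiset" "'p fm multiset"  (infix "\<Rrightarrow>" 55)

abbreviation boxes :: "'p fm multiset \<Rightarrow> 'p fm multiset" where
  "boxes \<Pi> \<equiv> image_mset Box \<Pi>"


section \<open>The calculus Grz-Seq with cut\<close>

text \<open>Proofs here are finite trees, so provability is the least predicate closed
  under the rules.\<close>

inductive grz_seq_cut :: "'p sequent \<Rightarrow> bool" where
  init: "grz_seq_cut (add_mset A \<Gamma> \<Rrightarrow> add_mset A \<Delta>)"
| bot: "grz_seq_cut (add_mset Bot \<Gamma> \<Rrightarrow> \<Delta>)"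
| impL: "grz_seq_cut (add_mset B \<Gamma> \<Rrightarrow> \<Delta>) \<Longrightarrow> grz_seq_cut (\<Gamma> \<Rrightarrow> add_mset A \<Delta>) \<Longrightarrow>
    grz_seq_cut (add_mset (A \<^bold>\<longrightarrow> B) \<Gamma> \<Rrightarrow> \<Delta>)"
| impR: "grz_seq_cut (add_mset A \<Gamma> \<Rrightarrow> add_mset B \<Delta>) \<Longrightarrow>
    grz_seq_cut (\<Gamma> \<Rrightarrow> add_mset (A \<^bold>\<longrightarrow> B) \<Delta>)"
| refl: "grz_seq_cut (add_mset A (add_mset (Box A) \<Gamma>) \<Rrightarrow> \<Delta>) \<Longrightarrow>
    grz_seq_cut (add_mset (Box A) \<Gamma> \<Rrightarrow> \<Delta>)"
| cut: "grz_seq_cut (\<Gamma> \<Rrightarrow> add_mset A \<Delta>) \<Longrightarrow> grz_seq_cut (add_mset A \<Gamma> \<Rrightarrow> \<Delta>) \<Longrightarrow>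
    grz_seq_cut (\<Gamma> \<Rrightarrow> \<Delta>)"
| boxGrz: "grz_seq_cut (add_mset (Box (A \<^bold>\<longrightarrow> Box A)) (boxes \<Pi>) \<Rrightarrow> {#A#}) \<Longrightarrow>
    grz_seq_cut (\<Gamma> + boxes \<Pi> \<Rrightarrow> add_mset (Box A) \<Delta>)"


section \<open>The non-well-founded calculus Grz-infinity with cut\<close>

datatype rule_name = Initial | ImpL | ImpR | Refl | Cut | BoxR

text \<open>\<open>inf_rule r Ps S\<close>: there is an instance of rule \<open>r\<close> with conclusion \<open>S\<close>
  whose premises, from left to right, are \<open>Ps\<close>.  Initial sequents are the instances
  without premises.\<close>

inductive inf_rule :: "rule_name \<Rightarrow> 'p sequent list \<Rightarrow> 'p sequent \<Rightarrow> bool" where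
  init: "inf_rule Initial [] (add_mset (Atom p) \<Gamma> \<Rrightarrow> add_mset (Atom p) \<Delta>)"
| bot: "inf_rule Initial [] (add_mset Bot \<Gamma> \<Rrightarrow> \<Delta>)"
| impL: "inf_rule ImpL [add_mset B \<Gamma> \<Rrightarrow> \<Delta>, \<Gamma> \<Rrightarrow> add_mset A \<Delta>]
    (add_mset (A \<^bold>\<longrightarrow> B) \<Gamma> \<Rrightarrow> \<Delta>)"
| impR: "inf_rule ImpR [add_mset A \<Gamma> \<Rrightarrow> add_mset B \<Delta>] (\<Gamma> \<Rrightarrow> add_mset (A \<^bold>\<longrightarrow> B) \<Delta>)"
| refl: "inf_rule Refl [add_mset A (add_mset (Box A) \<Gamma>) \<Rrightarrow> \<Delta>] (add_mset (Box A) \<Gamma> \<Rrightarrow> \<Delta>)"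
| cut: "inf_rule Cut [\<Gamma> \<Rrightarrow> add_mset A \<Delta>, add_mset A \<Gamma> \<Rrightarrow> \<Delta>] (\<Gamma> \<Rrightarrow> \<Delta>)"
| box: "inf_rule BoxR [\<Gamma> + boxes \<Pi> \<Rrightarrow> add_mset A \<Delta>, boxes \<Pi> \<Rrightarrow> {#A#}]
    (\<Gamma> + boxes \<Pi> \<Rrightarrow> add_mset (Box A) \<Delta>)"

text \<open>Possibly infinite trees.  Besides its sequent, each node records the rule by
  which it is inferred from its children.\<close>

codatatype 'p ptree =
  Node (root: "'p sequent") (rule_of: rule_name) (children: "'p ptree list")

coinductive locally_correct :: "'p ptree \<Rightarrow> bool" where
  "inf_rule (rule_of t) (map root (children t)) (root t) \<Longrightarrow>
   (\<And>t'. t' \<in> set (children t) \<Longrightarrow> locally_correct t') \<Longrightarrow> locally_correct t"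

text \<open>An infinite branch of \<open>t\<close> is given by the subtrees \<open>s n\<close> rooted at its nodes and
  the position \<open>d n\<close>, counted from 0, of the child through which it continues.\<close>

definition infinite_branch :: "'p ptree \<Rightarrow> (nat \<Rightarrow> 'p ptree) \<Rightarrow> (nat \<Rightarrow> nat) \<Rightarrow> bool" where
  "infinite_branch t s d \<longleftrightarrow> s 0 = t \<and>
     (\<forall>n. d n < length (children (s n)) \<and> s (Suc n) = children (s n) ! d n)"

definition inf_proof :: "'p ptree \<Rightarrow> bool" where
  "inf_proof t \<longleftrightarrow> locally_correct t \<and>
     (\<forall>s d. infinite_branch t s d \<longrightarrow> infinite {n. rule_of (s n) = BoxR \<and> d n = 1})"

definition grz_inf_cut :: "'p sequent \<Rightarrow> bool" where
  "grz_inf_cut S \<longleftrightarrow> (\<exists>t. inf_proof t \<and> root t = S)"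

end

theory Submission
  imports Defs
begin

text \<open>
  An \<open>\<infinity>\<close>-proof can be cut at every right premise of \<open>(\<box>)\<close>.  What remains are fragments
  without infinite branches, and each of them ends in initial sequents and in right premises
  from which the proof continues.  Conversely, let \<open>X\<close> be a set of sequents each of which is
  the root of a finite fragment whose open right premises are again in \<open>X\<close>.  Unfolding the
  fragments into each other forever gives an \<open>\<infinity>\<close>-proof of every member of \<open>X\<close>: inside a
  fragment the height decreases, so an infinite branch must leave fragments infinitely often
  (\<open>inf_proof_unfold_proof\<close>, \<open>grz_inf_cut_coinduct\<close>).

  The set \<open>X\<close> of sequents provable in \<open>Grz\<^sub>S\<^sub>e\<^sub>q + cut\<close> has this property.  The only rule
  that does not translate directly is \<open>(\<box>\<^sub>G\<^sub>r\<^sub>z)\<close>, with premise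
  \<open>\<box>\<Pi>, G \<Rightarrow> A\<close> for \<open>G = \<box>(A \<rightarrow> \<box>A)\<close>.  Its conclusion \<open>\<Gamma>, \<box>\<Pi> \<Rightarrow> \<box>A, \<Delta>\<close> is inferred by
  \<open>(\<box>)\<close>.  The right premise \<open>\<box>\<Pi> \<Rightarrow> A\<close> has a proof in \<open>Grz\<^sub>S\<^sub>e\<^sub>q + cut\<close> and is left open.
  The left premise \<open>\<Gamma>, \<box>\<Pi> \<Rightarrow> A, \<Delta>\<close> is obtained by a cut on \<open>G\<close>: one premise of the cut is a
  weakening of the premise of \<open>(\<box>\<^sub>G\<^sub>r\<^sub>z)\<close>, and the other, \<open>\<Gamma>, \<box>\<Pi> \<Rightarrow> G, A, \<Delta>\<close>, follows by
  \<open>(\<box>)\<close> from \<open>\<Gamma>, \<box>\<Pi> \<Rightarrow> A \<rightarrow> \<box>A, A, \<Delta>\<close>, where \<open>A\<close> occurs on both sides after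
  \<open>(\<rightarrow>\<^sub>R)\<close>, and the open right premise \<open>\<box>\<Pi> \<Rightarrow> A \<rightarrow> \<box>A\<close>.
\<close>

section \<open>Fragments with open right premises\<close>

abbreviation right_premise :: "rule_name \<Rightarrow> nat \<Rightarrow> bool" where
  "right_premise r i \<equiv> r = BoxR \<and> i = 1"

text \<open>The number \<open>n\<close> bounds the height of the fragment; \<open>X\<close> is the set of sequents allowed
  at the right premises where it is cut off.  The bound is what later makes a choice of last
  rules well-founded.\<close>

inductive fragment :: "('p sequent \<Rightarrow> bool) \<Rightarrow> nat \<Rightarrow> 'p sequent \<Rightarrow> bool" for X where
  fragment_step: "inf_rule r Ps S \<Longrightarrow>
    (\<And>i. i < length Ps \<Longrightarrow> right_premise r i \<Longrightarrow> X (Ps ! i)) \<Longrightarrow>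
    (\<And>i. i < length Ps \<Longrightarrow> \<not> right_premise r i \<Longrightarrow> \<exists>m<n. fragment X m (Ps ! i)) \<Longrightarrow>
    fragment X n S"

definition derivable :: "('p sequent \<Rightarrow> bool) \<Rightarrow> 'p sequent \<Rightarrow> bool" where
  "derivable X S \<longleftrightarrow> (\<exists>n. fragment X n S)"

text \<open>Rules have finitely many premises, so the heights of the fragments above the premises
  have a common bound.\<close>

lemma derivable_rule:
  assumes "inf_rule r Ps S"
    and "\<And>i. i < length Ps \<Longrightarrow> right_premise r i \<Longrightarrow> X (Ps ! i)"
    and "\<And>i. i < length Ps \<Longrightarrow> \<not> right_premise r i \<Longrightarrow> derivable X (Ps ! i)"
  shows "derivable X S"
proof -
  have "\<forall>i. \<exists>m. i < length Ps \<and> \<not> right_premise r i \<longrightarrow> fragment X m (Ps ! i)"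
    using assms(3) unfolding derivable_def by blast
  then obtain h where h: "\<And>i. i < length Ps \<Longrightarrow> \<not> right_premise r i \<Longrightarrow> fragment X (h i) (Ps ! i)"
    by metis
  let ?n = "Suc (\<Sum>i<length Ps. h i)"
  have "h i < ?n" if "i < length Ps" for i
    using that by (simp add: le_imp_less_Suc member_le_sum)
  with h have "fragment X ?n S"
    using assms(1,2) by (intro fragment_step) blast+
  then show ?thesis
    unfolding derivable_def by blast
qed

lemma derivable_atom: "derivable X (add_mset (Atom p) \<Gamma> \<Rrightarrow> add_mset (Atom p) \<Delta>)"
  by (rule derivable_rule[OF inf_rule.init]) auto

lemma derivable_bot: "derivable X (add_mset Bot \<Gamma> \<Rrightarrow> \<Delta>)"
  by (rule derivable_rule[OF inf_rule.bot]) auto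

lemma derivable_impL:
  assumes "derivable X (add_mset B \<Gamma> \<Rrightarrow> \<Delta>)" and "derivable X (\<Gamma> \<Rrightarrow> add_mset A \<Delta>)"
  shows "derivable X (add_mset (A \<^bold>\<longrightarrow> B) \<Gamma> \<Rrightarrow> \<Delta>)"
  by (rule derivable_rule[OF inf_rule.impL]) (use assms in \<open>auto simp: less_Suc_eq\<close>)

lemma derivable_impR:
  assumes "derivable X (add_mset A \<Gamma> \<Rrightarrow> add_mset B \<Delta>)"
  shows "derivable X (\<Gamma> \<Rrightarrow> add_mset (A \<^bold>\<longrightarrow> B) \<Delta>)"
  by (rule derivable_rule[OF inf_rule.impR]) (use assms in auto)

lemma derivable_refl:
  assumes "derivable X (add_mset A (add_mset (Box A) \<Gamma>) \<Rrightarrow> \<Delta>)"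
  shows "derivable X (add_mset (Box A) \<Gamma> \<Rrightarrow> \<Delta>)"
  by (rule derivable_rule[OF inf_rule.refl]) (use assms in auto)

lemma derivable_cut:
  assumes "derivable X (\<Gamma> \<Rrightarrow> add_mset A \<Delta>)" and "derivable X (add_mset A \<Gamma> \<Rrightarrow> \<Delta>)"
  shows "derivable X (\<Gamma> \<Rrightarrow> \<Delta>)"
  by (rule derivable_rule[OF inf_rule.cut]) (use assms in \<open>auto simp: less_Suc_eq\<close>)

lemma derivable_box:
  assumes "derivable X (\<Gamma> + boxes \<Pi> \<Rrightarrow> add_mset A \<Delta>)" and "X (boxes \<Pi> \<Rrightarrow> {#A#})"
  shows "derivable X (\<Gamma> + boxes \<Pi> \<Rrightarrow> add_mset (Box A) \<Delta>)"
  by (rule derivable_rule[OF inf_rule.box]) (use assms in \<open>auto simp: less_Suc_eq\<close>)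


section \<open>Weakening\<close>

primrec weaken :: "'p fm multiset \<Rightarrow> 'p fm multiset \<Rightarrow> 'p sequent \<Rightarrow> 'p sequent" where
  "weaken \<Gamma>' \<Delta>' (\<Gamma> \<Rrightarrow> \<Delta>) = (\<Gamma> + \<Gamma>' \<Rrightarrow> \<Delta> + \<Delta>')"

text \<open>Every rule carries side formulas into its premises, except into the right premise of
  \<open>(\<box>)\<close>, which can stay as it is.  Hence weakening never touches an open premise.\<close>

lemma inf_rule_weaken:
  assumes "inf_rule r Ps S"
  shows "inf_rule r
    (map (\<lambda>i. if right_premise r i then Ps ! i else weaken \<Gamma>' \<Delta>' (Ps ! i)) [0..<length Ps])
    (weaken \<Gamma>' \<Delta>' S)"
  using assms
proof cases
  case (box \<Gamma> \<Pi> A \<Delta>)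
  then show ?thesis
    using inf_rule.box[of "\<Gamma> + \<Gamma>'" \<Pi> A "\<Delta> + \<Delta>'"] by (simp add: ac_simps)
qed (auto intro: inf_rule.intros)

lemma fragment_weaken:
  assumes "fragment X n S"
  shows "fragment X n (weaken \<Gamma>' \<Delta>' S)"
  using assms
proof induction
  case (fragment_step r Ps S n)
  show ?case
    by (rule fragment.fragment_step[OF inf_rule_weaken[OF fragment_step(1)]])
      (use fragment_step(2,3) in auto)
qed

lemma derivable_weaken:
  assumes "derivable X (\<Gamma> \<Rrightarrow> \<Delta>)"
  shows "derivable X (\<Gamma> + \<Gamma>' \<Rrightarrow> \<Delta> + \<Delta>')"
  using assms fragment_weaken[of X _ "\<Gamma> \<Rrightarrow> \<Delta>" \<Gamma>' \<Delta>'] unfolding derivable_def by auto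


section \<open>Unfolding fragments into infinite proofs\<close>

primcorec unfold_proof ::
    "('p sequent \<Rightarrow> rule_name) \<Rightarrow> ('p sequent \<Rightarrow> 'p sequent list) \<Rightarrow> 'p sequent \<Rightarrow> 'p ptree" where
  "unfold_proof r Ps S = Node S (r S) (map (unfold_proof r Ps) (Ps S))"

text \<open>A rank in the natural numbers that decreases at all premises other than the right
  premises of \<open>(\<box>)\<close> cannot decrease forever, so no infinite branch eventually avoids
  right premises.\<close>

lemma inf_proof_unfold_proof:
  fixes rank :: "'p sequent \<Rightarrow> nat"
  assumes rule: "\<And>S. D S \<Longrightarrow> inf_rule (r S) (Ps S) S"
    and closed: "\<And>S i. D S \<Longrightarrow> i < length (Ps S) \<Longrightarrow> D (Ps S ! i)"
    and rank: "\<And>S i. D S \<Longrightarrow> i < length (Ps S) \<Longrightarrow> \<not> right_premise (r S) i \<Longrightarrow>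
      rank (Ps S ! i) < rank S"
    and "D S"
  shows "inf_proof (unfold_proof r Ps S)"
proof -
  let ?t = "unfold_proof r Ps"
  have "locally_correct (?t S)"
    using \<open>D S\<close>
  proof (coinduction arbitrary: S)
    case locally_correct
    then have "inf_rule (rule_of (?t S)) (map root (children (?t S))) (root (?t S))"
      using rule by (simp add: comp_def)
    moreover have "\<exists>S'. t' = ?t S' \<and> D S'" if "t' \<in> set (children (?t S))" for t'
      using that closed locally_correct by (fastforce simp: in_set_conv_nth)
    ultimately show ?case
      by auto
  qed
  moreover have "infinite {n. rule_of (s n) = BoxR \<and> d n = 1}"
    if branch: "infinite_branch (?t S) s d" for s d
  proof
    assume "finite {n. rule_of (s n) = BoxR \<and> d n = 1}"
    then obtain N where N: "\<And>n. n \<ge> N \<Longrightarrow> \<not> right_premise (rule_of (s n)) (d n)"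
      by (auto simp: finite_nat_set_iff_bounded not_less[symmetric])
    have succ: "d n < length (Ps S') \<and> s (Suc n) = ?t (Ps S' ! d n)" if "s n = ?t S'" for n S'
      using branch that unfolding infinite_branch_def
      by (metis length_map nth_map unfold_proof.sel(3))
    have state: "s n = ?t (root (s n)) \<and> D (root (s n))" for n
    proof (induction n)
      case 0
      then show ?case
        using branch \<open>D S\<close> by (simp add: infinite_branch_def)
    next
      case (Suc n)
      then show ?case
        using succ[of n "root (s n)"] closed by simp
    qed
    have "rank (root (s (Suc n))) < rank (root (s n))" if "n \<ge> N" for n
    proof -
      have "rule_of (s n) = r (root (s n))"
        using state[of n] by (metis unfold_proof.sel(2))
      then show ?thesis
        using rank[of "root (s n)" "d n"] succ[of n "root (s n)"] state[of n] N[OF that] by simp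
    qed
    then have "\<forall>k. (rank (root (s (N + Suc k))), rank (root (s (N + k)))) \<in> less_than"
      by simp
    then show False
      using wf_less_than unfolding wf_iff_no_infinite_down_chain
      by (auto dest: spec[of _ "\<lambda>k. rank (root (s (N + k)))"])
  qed
  ultimately show ?thesis
    unfolding inf_proof_def by blast
qed

text \<open>The rank of a sequent is the least height of a fragment for it; the last rule of a
  fragment of that height has premises of smaller rank.\<close>

lemma grz_inf_cut_coinduct:
  assumes X: "\<And>S. X S \<Longrightarrow> derivable X S" and "X S"
  shows "grz_inf_cut S"
proof -
  define rank where "rank S = (LEAST n. fragment X n S)" for S
  have "\<exists>r Ps. inf_rule r Ps S \<and> (\<forall>i<length Ps. derivable X (Ps ! i) \<and>
      (\<not> right_premise r i \<longrightarrow> rank (Ps ! i) < rank S))" if "derivable X S" for S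
  proof -
    have "fragment X (rank S) S"
      using that unfolding derivable_def rank_def by (rule LeastI_ex)
    then show ?thesis
    proof cases
      case (fragment_step r Ps)
      have "derivable X (Ps ! i) \<and> (\<not> right_premise r i \<longrightarrow> rank (Ps ! i) < rank S)"
        if i: "i < length Ps" for i
      proof (cases "right_premise r i")
        case True
        then show ?thesis
          using fragment_step(2) X i by blast
      next
        case False
        then obtain m where "m < rank S" "fragment X m (Ps ! i)"
          using fragment_step(3) i by blast
        moreover from this(2) have "rank (Ps ! i) \<le> m"
          unfolding rank_def by (rule Least_le)
        ultimately show ?thesis
          unfolding derivable_def by auto
      qed
      with fragment_step(1) show ?thesis
        by blast
    qed
  qed
  then obtain r Ps where step: "\<And>S. derivable X S \<Longrightarrow> inf_rule (r S) (Ps S) S \<and>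
      (\<forall>i<length (Ps S). derivable X (Ps S ! i) \<and>
        (\<not> right_premise (r S) i \<longrightarrow> rank (Ps S ! i) < rank S))"
    by metis
  have "inf_proof (unfold_proof r Ps S)"
    by (rule inf_proof_unfold_proof[where D = "derivable X" and rank = rank])
      (use step X \<open>X S\<close> in blast)+
  then show ?thesis
    unfolding grz_inf_cut_def by (metis unfold_proof.sel(1))
qed


section \<open>Fragments for the rules of Grz-Seq with cut\<close>

text \<open>Initial sequents of the infinitary calculus are atomic.  For a boxed formula,
  \<open>(refl)\<close> makes \<open>A\<close> available as an antecedent of the left premise of \<open>(\<box>)\<close>, and the right
  premise is the sequent \<open>\<box>A \<Rightarrow> A\<close>, which may be left open.\<close>

lemma derivable_identity:
  assumes "\<And>A. X ({#Box A#} \<Rrightarrow> {#A#})"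
  shows "derivable X (add_mset A \<Gamma> \<Rrightarrow> add_mset A \<Delta>)"
proof (induction A arbitrary: \<Gamma> \<Delta>)
  case Bot
  show ?case
    by (rule derivable_bot)
next
  case (Atom p)
  show ?case
    by (rule derivable_atom)
next
  case (Imp A B)
  have "derivable X (add_mset (A \<^bold>\<longrightarrow> B) (add_mset A \<Gamma>) \<Rrightarrow> add_mset B \<Delta>)"
  proof (rule derivable_impL)
    show "derivable X (add_mset B (add_mset A \<Gamma>) \<Rrightarrow> add_mset B \<Delta>)"
      by (rule Imp.IH)
    show "derivable X (add_mset A \<Gamma> \<Rrightarrow> add_mset A (add_mset B \<Delta>))"
      by (rule Imp.IH)
  qed
  then show ?case
    by (intro derivable_impR) (simp add: add_mset_commute)
next
  case (Box A)
  have "derivable X (add_mset A \<Gamma> + boxes {#A#} \<Rrightarrow> add_mset (Box A) \<Delta>)"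
    using Box.IH[of "add_mset (Box A) \<Gamma>" \<Delta>] assms
    by (intro derivable_box) (simp_all add: add_mset_commute)
  then show ?case
    by (intro derivable_refl) (simp add: add_mset_commute)
qed

lemma grz_seq_cut_unbox: "grz_seq_cut ({#Box A#} \<Rrightarrow> {#A#})"
  by (intro grz_seq_cut.refl grz_seq_cut.init)

text \<open>The next two lemmas provide the two right premises left open in the translation
  of \<open>(\<box>\<^sub>G\<^sub>r\<^sub>z)\<close>.\<close>

lemma grz_seq_cut_unboxed_conclusion:
  assumes "grz_seq_cut (add_mset (Box (A \<^bold>\<longrightarrow> Box A)) (boxes \<Pi>) \<Rrightarrow> {#A#})"
  shows "grz_seq_cut (boxes \<Pi> \<Rrightarrow> {#A#})"
proof (rule grz_seq_cut.cut[where A = "Box A"])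
  show "grz_seq_cut (boxes \<Pi> \<Rrightarrow> {#Box A, A#})"
    using grz_seq_cut.boxGrz[OF assms, of "{#}" "{#A#}"] by simp
  show "grz_seq_cut (add_mset (Box A) (boxes \<Pi>) \<Rrightarrow> {#A#})"
    by (intro grz_seq_cut.refl grz_seq_cut.init)
qed

lemma grz_seq_cut_imp_box:
  assumes "grz_seq_cut (add_mset (Box (A \<^bold>\<longrightarrow> Box A)) (boxes \<Pi>) \<Rrightarrow> {#A#})"
  shows "grz_seq_cut (boxes \<Pi> \<Rrightarrow> {#A \<^bold>\<longrightarrow> Box A#})"
  using grz_seq_cut.boxGrz[OF assms, of "{#A#}" "{#}"] by (intro grz_seq_cut.impR) simp

lemma grz_seq_cut_derivable:
  assumes "grz_seq_cut S"
  shows "derivable grz_seq_cut S"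
  using assms
proof induction
  case (boxGrz A \<Pi> \<Gamma> \<Delta>)
  let ?G = "Box (A \<^bold>\<longrightarrow> Box A)"
  have "derivable grz_seq_cut (\<Gamma> + boxes \<Pi> \<Rrightarrow> add_mset (A \<^bold>\<longrightarrow> Box A) (add_mset A \<Delta>))"
  proof (rule derivable_impR)
    have "derivable grz_seq_cut (add_mset A (\<Gamma> + boxes \<Pi>) \<Rrightarrow> add_mset A (add_mset (Box A) \<Delta>))"
      by (rule derivable_identity) (rule grz_seq_cut_unbox)
    then show "derivable grz_seq_cut (add_mset A (\<Gamma> + boxes \<Pi>) \<Rrightarrow> add_mset (Box A) (add_mset A \<Delta>))"
      by (simp add: add_mset_commute)
  qed
  then have "derivable grz_seq_cut (\<Gamma> + boxes \<Pi> \<Rrightarrow> add_mset ?G (add_mset A \<Delta>))"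
    using grz_seq_cut_imp_box[OF boxGrz.hyps] by (rule derivable_box)
  moreover have "derivable grz_seq_cut (add_mset ?G (\<Gamma> + boxes \<Pi>) \<Rrightarrow> add_mset A \<Delta>)"
    using derivable_weaken[OF boxGrz.IH, of \<Gamma> \<Delta>] by (simp add: ac_simps)
  ultimately have "derivable grz_seq_cut (\<Gamma> + boxes \<Pi> \<Rrightarrow> add_mset A \<Delta>)"
    by (rule derivable_cut)
  then show ?case
    using grz_seq_cut_unboxed_conclusion[OF boxGrz.hyps] by (rule derivable_box)
qed (auto intro: derivable_identity grz_seq_cut_unbox derivable_bot derivable_impL derivable_impR
  derivable_refl derivable_cut)

theorem theorem5p3:
  fixes \<Gamma> \<Delta> :: "'p fm multiset"
  assumes "grz_seq_cut (\<Gamma> \<Rrightarrow> \<Delta>)"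
  shows "grz_inf_cut (\<Gamma> \<Rrightarrow> \<Delta>)"
  using grz_seq_cut_derivable assms by (rule grz_inf_cut_coinduct)

end
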